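(* Assume that there exist constants $C_0,\gamma>0$ and, for all $x,y\in E$, a Markovian coupling measure $\mathbb{P}_{(x,y)}$ between $\mathbb{P}_x$ and $\mathbb{P}_y$ such that for all $t\in I$, $$d(X_t,Y_t)\le C_0e^{-\gamma t}d(x,y)\qquad\mathbb{P}_{(x,y)}\text{-almost surely}.$$ Then the couplings $\mathbb{P}_{(x,y)}$ satisfy, for all $x,y\in E$ and $t\in I$: (A') $\ \mathbb{E}_{(x,y)}[G^X_t\,d(X_t,Y_t)]\le\gamma(t)\,d(x,y)$ with $\gamma(t)=C_0e^{-\gamma t}$; (B) $\ \mathbb{E}_{(x,y)}|Z^X_t-Z^Y_t|\le C_B\,d(x,y)\,\mathbb{E}_xZ_t$, where in the discrete time case $I=\mathbb{Z}_+$ $$C_B=\frac{C_0e^{\mathrm{osc}(\rho)}\|\rho\|_{\mathrm{Lip}(d)}}{1-e^{-\gamma}}\exp\left(\frac{C_0e^{\mathrm{osc}(\rho)}\|\rho\|_{\mathrm{Lip}(d)}\,\bar d}{1-e^{-\gamma}}\right),$$ and in the continuous time case $I=[0,+\infty)$ $$C_B=\|\rho\|_{\mathrm{Lip}(d)}\frac{C_0}\gamma\exp\left(\|\rho\|_{\mathrm{Lip}(d)}\frac{C_0}\gamma\bar d\right);$$ (C) $\ \mathbb{E}_{(x,y)}[G^X_t\wedge G^Y_t]\ge\frac1{C_C}$ with, in both cases, $C_C=(1+C_B\bar d)^2$.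
   Context: Setting. $(E,d)$ is a Polish space whose distance satisfies $d\le\bar d$ on $E\times E$ for a finite constant $\bar d$. The time set $I$ is either $[0,+\infty)$ or $\mathbb{Z}_+$. $(\Omega,(\mathcal F_t)_{t\in I},(\mathbb{P}_x)_{x\in E},(X_t)_{t\in I})$ is a time-homogeneous Markov process in $E$ with $\mathbb{P}_x(X_0=x)=1$; $\mathbb{E}_x$ is the expectation under $\mathbb{P}_x$. The function $\rho:E\to\mathbb{R}_+$ is $d$-Lipschitz, with $\|\rho\|_{\mathrm{Lip}(d)}=\sup_{x\ne y}\frac{|\rho(x)-\rho(y)|}{d(x,y)}$ and $\mathrm{osc}(\rho)=\sup_E\rho-\inf_E\rho$. The penalization is $Z_t=Z_t(X)=e^{-\int_0^t\rho(X_s)ds}$ if $I=[0,+\infty)$ (the integral being assumed well defined), and $Z_t=Z_t(X)=p(X_0)p(X_1)\cdots p(X_{t-1})$ with $p=e^{-\rho}$ (and $Z_0=1$) if $I=\mathbb{Z}_+$. Couplings. A coupling measure between $\mathbb{P}_x$ and $\mathbb{P}_y$ is a probability measure $\mathbb{P}_{(x,y)}$ on a space carrying $(X_t,Y_t)_{t\in I}$ such that $(X_t)$ has the law of $X$ under $\mathbb{P}_x$ and $(Y_t)$ the law of $X$ under $\mathbb{P}_y$. It is Markovian if $(X_t,Y_t)_{t\in I}$ is Markov with respect to its natural filtration. Write $Z^X_t=Z_t(X)$, $Z^Y_t=Z_t(Y)$, $G^X_t=Z^X_t/\mathbb{E}_xZ_t$, $G^Y_t=Z^Y_t/\mathbb{E}_yZ_t$.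 *)

theory Defs
  imports "HOL-Probability.Probability"
begin

text \<open>
  The state space is a type of class \<open>polish_space\<close> with \<open>d = dist\<close> and its Borel sets.
  The time set \<open>I\<close> is a set of reals, equal to \<open>{0..}\<close> or to \<open>\<nat>\<close>; processes are functions
  \<open>real \<Rightarrow> 'w \<Rightarrow> 'e\<close> whose values at times outside \<open>I\<close> are irrelevant.
\<close>

definition homogeneous_markov_process ::
  "real set \<Rightarrow> (real \<Rightarrow> 'w measure) \<Rightarrow> ('e :: polish_space \<Rightarrow> 'w measure) \<Rightarrow> (real \<Rightarrow> 'w \<Rightarrow> 'e) \<Rightarrow> bool"
  where
  "homogeneous_markov_process I F P X \<longleftrightarrow>
     (\<forall>x. prob_space (P x)) \<and>
     (\<forall>x y. sets (P x) = sets (P y)) \<and>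
     (\<forall>x. \<forall>t\<in>I. subalgebra (P x) (F t)) \<and>
     (\<forall>s\<in>I. \<forall>t\<in>I. s \<le> t \<longrightarrow> sets (F s) \<subseteq> sets (F t)) \<and>
     (\<forall>t\<in>I. X t \<in> F t \<rightarrow>\<^sub>M borel) \<and>
     (\<forall>x. measure (P x) {\<omega> \<in> space (P x). X 0 \<omega> = x} = 1) \<and>
     (\<forall>t\<in>I. \<forall>A\<in>sets borel.
        (\<lambda>x. measure (P x) {\<omega> \<in> space (P x). X t \<omega> \<in> A}) \<in> borel_measurable borel) \<and>
     (\<forall>x. \<forall>s\<in>I. \<forall>t\<in>I. \<forall>A\<in>sets borel. AE \<omega> in P x.
        real_cond_exp (P x) (F s) (\<lambda>\<omega>'. indicator A (X (s + t) \<omega>')) \<omega>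
          = measure (P (X s \<omega>)) {\<omega>' \<in> space (P (X s \<omega>)). X t \<omega>' \<in> A})"

definition natural_filtration ::
  "real set \<Rightarrow> 'w measure \<Rightarrow> (real \<Rightarrow> 'w \<Rightarrow> 'e :: topological_space) \<Rightarrow> real \<Rightarrow> 'w measure"
  where
  "natural_filtration I M W s =
     sigma (space M) {W u -` A \<inter> space M | u A. u \<in> I \<and> u \<le> s \<and> A \<in> sets borel}"

definition markov_natural ::
  "real set \<Rightarrow> 'w measure \<Rightarrow> (real \<Rightarrow> 'w \<Rightarrow> 'e :: topological_space) \<Rightarrow> bool"
  where
  "markov_natural I M W \<longleftrightarrow>
     (\<forall>t\<in>I. W t \<in> M \<rightarrow>\<^sub>M borel) \<and>
     (\<forall>s\<in>I. \<forall>t\<in>I. \<forall>A\<in>sets borel. s \<le> t \<longrightarrow> (AE \<omega> in M.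
        real_cond_exp M (natural_filtration I M W s) (\<lambda>\<omega>'. indicator A (W t \<omega>')) \<omega>
          = real_cond_exp M (vimage_algebra (space M) (W s) borel) (\<lambda>\<omega>'. indicator A (W t \<omega>')) \<omega>))"

text \<open>The law of a process is its distribution on the product space \<open>E\<^sup>I\<close>.\<close>

definition process_law ::
  "real set \<Rightarrow> 'w measure \<Rightarrow> (real \<Rightarrow> 'w \<Rightarrow> 'e :: topological_space) \<Rightarrow> (real \<Rightarrow> 'e) measure"
  where
  "process_law I M X = distr M (PiM I (\<lambda>_. borel)) (\<lambda>\<omega>. \<lambda>t\<in>I. X t \<omega>)"

definition coupling ::
  "real set \<Rightarrow> ('e :: polish_space \<Rightarrow> 'w measure) \<Rightarrow> (real \<Rightarrow> 'w \<Rightarrow> 'e) \<Rightarrow> 'e \<Rightarrow> 'e \<Rightarrow>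
   'v measure \<Rightarrow> (real \<Rightarrow> 'v \<Rightarrow> 'e) \<Rightarrow> (real \<Rightarrow> 'v \<Rightarrow> 'e) \<Rightarrow> bool"
  where
  "coupling I P X x y Q X' Y' \<longleftrightarrow>
     prob_space Q \<and>
     (\<forall>t\<in>I. X' t \<in> Q \<rightarrow>\<^sub>M borel) \<and> (\<forall>t\<in>I. Y' t \<in> Q \<rightarrow>\<^sub>M borel) \<and>
     process_law I Q X' = process_law I (P x) X \<and>
     process_law I Q Y' = process_law I (P y) X"

definition markovian_coupling ::
  "real set \<Rightarrow> ('e :: polish_space \<Rightarrow> 'w measure) \<Rightarrow> (real \<Rightarrow> 'w \<Rightarrow> 'e) \<Rightarrow> 'e \<Rightarrow> 'e \<Rightarrow>
   'v measure \<Rightarrow> (real \<Rightarrow> 'v \<Rightarrow> 'e) \<Rightarrow> (real \<Rightarrow> 'v \<Rightarrow> 'e) \<Rightarrow> bool"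
  where
  "markovian_coupling I P X x y Q X' Y' \<longleftrightarrow>
     coupling I P X x y Q X' Y' \<and> markov_natural I Q (\<lambda>t \<omega>. (X' t \<omega>, Y' t \<omega>))"

text \<open>The 0 only matters on a one-point space, where the supremum is over the empty set.\<close>

definition lip_norm :: "('e :: metric_space \<Rightarrow> real) \<Rightarrow> real" where
  "lip_norm \<rho> = Sup (insert 0 {\<bar>\<rho> x - \<rho> y\<bar> / dist x y | x y. x \<noteq> y})"

definition osc :: "('e \<Rightarrow> real) \<Rightarrow> real" where
  "osc \<rho> = Sup (range \<rho>) - Inf (range \<rho>)"

definition penal :: "real set \<Rightarrow> ('e \<Rightarrow> real) \<Rightarrow> (real \<Rightarrow> 'w \<Rightarrow> 'e) \<Rightarrow> real \<Rightarrow> 'w \<Rightarrow> real" where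
  "penal I \<rho> X t \<omega> =
     (if I = {0..} then exp (- (LINT s:{0..t}|lborel. \<rho> (X s \<omega>)))
      else (\<Prod>k<nat \<lfloor>t\<rfloor>. exp (- \<rho> (X (real k) \<omega>))))"

text \<open>
  In continuous time, the integral of \<open>\<rho> (X s)\<close> is well defined as a random variable if
  \<open>\<rho> (X s)\<close> is a measurable process. This holds in particular for cadlag paths. Measurability
  of the individual paths alone would not make the law of the integral a function of the law
  of the process.
\<close>

definition penal_well_defined ::
  "real set \<Rightarrow> ('e \<Rightarrow> real) \<Rightarrow> 'w measure \<Rightarrow> (real \<Rightarrow> 'w \<Rightarrow> 'e) \<Rightarrow> bool" where
  "penal_well_defined I \<rho> M X \<longleftrightarrow>
     (I = {0..} \<longrightarrow> (\<lambda>(s, \<omega>). \<rho> (X s \<omega>)) \<in> borel_measurable (restrict_space borel {0..} \<Otimes>\<^sub>M M))"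

definition const_B :: "real set \<Rightarrow> ('e :: metric_space \<Rightarrow> real) \<Rightarrow> real \<Rightarrow> real \<Rightarrow> real \<Rightarrow> real" where
  "const_B I \<rho> C\<^sub>0 \<gamma> dbar =
     (if I = {0..} then lip_norm \<rho> * (C\<^sub>0 / \<gamma>) * exp (lip_norm \<rho> * (C\<^sub>0 / \<gamma>) * dbar)
      else C\<^sub>0 * exp (osc \<rho>) * lip_norm \<rho> / (1 - exp (- \<gamma>))
             * exp (C\<^sub>0 * exp (osc \<rho>) * lip_norm \<rho> * dbar / (1 - exp (- \<gamma>))))"

end

theory Submission
  imports Defs
begin

text \<open>
  Write \<open>Z = exp (- a)\<close> for both coordinates. The contraction makes the two exponents
  differ by at most \<open>K = \<kappa> d(x,y)\<close> almost surely, with \<open>\<kappa>\<close> the Lipschitz norm times the total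
  mass of \<open>C\<^sub>0 exp (- \<gamma> s)\<close>, and all three bounds follow pathwise from
  \<open>exp (- K) \<le> Z\<^sup>X / Z\<^sup>Y \<le> exp K\<close> and \<open>exp K \<le> 1 + K exp K\<close>.
  In continuous time, the expectation of \<open>Z\<close> is a function of the law of the process because
  the moments of \<open>a\<close> are, by Fubini, time integrals of finite-dimensional expectations, and
  \<open>a\<close> is bounded.
\<close>

section \<open>Pathwise comparison of two exponential weights\<close>

lemma exp_le_one_plus_mult_exp:
  fixes x :: real
  shows "exp x \<le> 1 + x * exp x"
proof -
  have "(1 - x) * exp x \<le> exp (- x) * exp x"
    using exp_ge_add_one_self[of "- x"] by (intro mult_right_mono) auto
  then show ?thesis
    by (simp add: algebra_simps flip: exp_add)
qed

text \<open>All three estimates of the theorem in abstract form: \<open>a\<close> and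
  \<open>b\<close> are the exponents of the two coordinates, \<open>D\<close> is their distance. The
  first holds because the normalized weight has mean 1. The second holds because the two weights
  differ by at most the factor \<open>exp K\<close> pathwise. In the third, \<open>exp K\<close> is
  lost twice, once in the weights and once in their normalizations.\<close>

lemma (in prob_space) penalized_coupling_bounds:
  fixes a b D :: "'a \<Rightarrow> real" and K L :: real
  assumes [measurable]: "a \<in> borel_measurable M" "b \<in> borel_measurable M"
    and nonneg: "\<And>\<omega>. 0 \<le> a \<omega>" "\<And>\<omega>. 0 \<le> b \<omega>"
    and diff: "AE \<omega> in M. \<bar>a \<omega> - b \<omega>\<bar> \<le> K"
    and D: "AE \<omega> in M. D \<omega> \<le> L" "0 \<le> L"
  defines "EA \<equiv> (\<integral>\<omega>. exp (- a \<omega>) \<partial>M)" and "EB \<equiv> (\<integral>\<omega>. exp (- b \<omega>) \<partial>M)"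
  shows "(\<integral>\<omega>. exp (- a \<omega>) / EA * D \<omega> \<partial>M) \<le> L"
    and "(\<integral>\<omega>. \<bar>exp (- a \<omega>) - exp (- b \<omega>)\<bar> \<partial>M) \<le> K * exp K * EA"
    and "(\<integral>\<omega>. min (exp (- a \<omega>) / EA) (exp (- b \<omega>) / EB) \<partial>M) \<ge> 1 / (exp K)\<^sup>2"
proof -
  have int [simp]: "integrable M (\<lambda>\<omega>. exp (- a \<omega>))" "integrable M (\<lambda>\<omega>. exp (- b \<omega>))"
    by (rule integrable_const_bound[where B=1]; use nonneg in auto)+
  have EA: "0 < EA" and EB: "0 < EB"
    using integral_less_AE_space[of "\<lambda>_. 0" "\<lambda>\<omega>. exp (- a \<omega>)"]
      integral_less_AE_space[of "\<lambda>_. 0" "\<lambda>\<omega>. exp (- b \<omega>)"]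
    by (simp_all add: EA_def EB_def emeasure_space_1)
  \<comment> \<open>\<open>integral_mono_AE'\<close> asks for integrability of the majorant only.
    Should the left integrand fail to be integrable, its integral is 0 by convention and
    \<open>0 \<le> L\<close> covers this case.\<close>
  have "(\<integral>\<omega>. exp (- a \<omega>) / EA * D \<omega> \<partial>M) \<le> (\<integral>\<omega>. exp (- a \<omega>) / EA * L \<partial>M)"
    by (rule integral_mono_AE')
       (use D EA in \<open>auto intro!: mult_left_mono mult_nonneg_nonneg divide_right_mono\<close>)
  also have "\<dots> = L"
    using EA by (simp add: EA_def)
  finally show "(\<integral>\<omega>. exp (- a \<omega>) / EA * D \<omega> \<partial>M) \<le> L" .
  have le: "exp (- b \<omega>) \<le> exp K * exp (- a \<omega>)" "exp (- a \<omega>) \<le> exp K * exp (- b \<omega>)"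
    if "\<bar>a \<omega> - b \<omega>\<bar> \<le> K" for \<omega>
    using that by (auto simp flip: exp_add)
  \<comment> \<open>Both signs of the difference are bounded by a multiple of
    \<open>exp (- a \<omega>)\<close>, since the right-hand side of (B) contains the expectation of
    the first weight only.\<close>
  have absdiff: "\<bar>exp (- a \<omega>) - exp (- b \<omega>)\<bar> \<le> K * exp K * exp (- a \<omega>)"
    if "\<bar>a \<omega> - b \<omega>\<bar> \<le> K" for \<omega>
  proof -
    have "exp (- b \<omega>) - exp (- a \<omega>) \<le> (exp K - 1) * exp (- a \<omega>)"
      using le(1)[OF that] by (simp add: algebra_simps)
    moreover have "exp (- b \<omega>) \<ge> (1 - K) * exp (- a \<omega>)"
    proof -
      have "(1 - K) * exp (- a \<omega>) \<le> exp (- K) * exp (- a \<omega>)"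
        using exp_ge_add_one_self[of "- K"] by (intro mult_right_mono) auto
      also have "\<dots> \<le> exp (- b \<omega>)"
        using that by (auto simp flip: exp_add)
      finally show ?thesis .
    qed
    moreover have "K * exp (- a \<omega>) \<le> K * exp K * exp (- a \<omega>)"
      using that by (intro mult_right_mono) (auto simp: mult_le_cancel_left1)
    moreover have "(exp K - 1) * exp (- a \<omega>) \<le> K * exp K * exp (- a \<omega>)"
      using exp_le_one_plus_mult_exp[of K] by (intro mult_right_mono) auto
    ultimately show ?thesis by (simp add: algebra_simps abs_le_iff)
  qed
  have "(\<integral>\<omega>. \<bar>exp (- a \<omega>) - exp (- b \<omega>)\<bar> \<partial>M) \<le> (\<integral>\<omega>. K * exp K * exp (- a \<omega>) \<partial>M)"
    using diff by (intro integral_mono_AE) (auto intro!: absdiff)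
  then show "(\<integral>\<omega>. \<bar>exp (- a \<omega>) - exp (- b \<omega>)\<bar> \<partial>M) \<le> K * exp K * EA"
    by (simp add: EA_def)
  have "EB \<le> (\<integral>\<omega>. exp K * exp (- a \<omega>) \<partial>M)"
    unfolding EB_def using diff by (intro integral_mono_AE) (auto intro!: le)
  then have EB_le: "EB \<le> exp K * EA"
    by (simp add: EA_def)
  have minle: "1 / (exp K)\<^sup>2 * (exp (- a \<omega>) / EA) \<le> min (exp (- a \<omega>) / EA) (exp (- b \<omega>) / EB)"
    if "\<bar>a \<omega> - b \<omega>\<bar> \<le> K" for \<omega>
  proof -
    have "1 \<le> exp K" using that by auto
    then have "1 \<le> (exp K)\<^sup>2" by simp
    then have "1 / (exp K)\<^sup>2 * (exp (- a \<omega>) / EA) \<le> 1 * (exp (- a \<omega>) / EA)"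
      using EA by (intro mult_right_mono) auto
    moreover have "1 / (exp K)\<^sup>2 * (exp (- a \<omega>) / EA) \<le> exp (- b \<omega>) / EB"
    proof -
      \<comment> \<open>One factor \<open>exp K\<close> goes to the numerator, where it turns
        \<open>a\<close> into \<open>b\<close>; the other goes to the denominator, where it turns
        \<open>EA\<close> into \<open>EB\<close>.\<close>
      have "1 / (exp K)\<^sup>2 * (exp (- a \<omega>) / EA) = (exp (- a \<omega>) / exp K) / (exp K * EA)"
        by (simp add: power2_eq_square)
      also have "\<dots> \<le> exp (- b \<omega>) / EB"
        using le(2)[OF that] EA EB EB_le by (intro frac_le) (auto simp: divide_le_eq mult.commute)
      finally show ?thesis .
    qed
    ultimately show ?thesis by simp
  qed
  have "1 / (exp K)\<^sup>2 = (\<integral>\<omega>. 1 / (exp K)\<^sup>2 * (exp (- a \<omega>) / EA) \<partial>M)"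
    using EA by (simp add: EA_def)
  also have "\<dots> \<le> (\<integral>\<omega>. min (exp (- a \<omega>) / EA) (exp (- b \<omega>) / EB) \<partial>M)"
    using diff minle by (intro integral_mono_AE integrable_min) auto
  finally show "(\<integral>\<omega>. min (exp (- a \<omega>) / EA) (exp (- b \<omega>) / EB) \<partial>M) \<ge> 1 / (exp K)\<^sup>2" .
qed

section \<open>Lipschitz norm, oscillation and functionals of the process law\<close>

text \<open>Any Lipschitz constant bounds the difference quotients, so the real-valued
  \<open>Sup\<close> is a true supremum and hence itself a Lipschitz constant.\<close>

lemma lip_norm_bound:
  fixes \<rho> :: "'e :: metric_space \<Rightarrow> real"
  assumes "\<exists>L. L-lipschitz_on UNIV \<rho>"
  shows "0 \<le> lip_norm \<rho>" "\<bar>\<rho> x - \<rho> y\<bar> \<le> lip_norm \<rho> * dist x y"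
proof -
  obtain L where L: "L-lipschitz_on UNIV \<rho>" using assms by blast
  let ?S = "insert 0 {\<bar>\<rho> x - \<rho> y\<bar> / dist x y | x y. x \<noteq> y}"
  have bdd: "bdd_above ?S"
    using lipschitz_onD[OF L] lipschitz_on_nonneg[OF L]
    by (intro bdd_aboveI[of _ L]) (auto simp: dist_real_def divide_le_eq)
  show "0 \<le> lip_norm \<rho>"
    unfolding lip_norm_def by (rule cSup_upper[OF _ bdd]) simp
  show "\<bar>\<rho> x - \<rho> y\<bar> \<le> lip_norm \<rho> * dist x y"
  proof (cases "x = y")
    case False
    then have "\<bar>\<rho> x - \<rho> y\<bar> / dist x y \<le> lip_norm \<rho>"
      unfolding lip_norm_def by (intro cSup_upper[OF _ bdd]) auto
    with False show ?thesis by (simp add: divide_le_eq)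
  qed simp
qed

lemma osc_nonneg:
  assumes "bdd_above (range \<rho>)" "bdd_below (range \<rho>)"
  shows "0 \<le> osc \<rho>"
proof -
  have "Inf (range \<rho>) \<le> Sup (range \<rho>)"
    using assms by (intro cInf_le_cSup) auto
  then show ?thesis by (simp add: osc_def)
qed

text \<open>Both sides are integrals of \<open>H\<close> against the same measure on the product
  space. Measurability for the product sigma-algebra restricts \<open>H\<close> to functionals of
  countably many coordinates; in continuous time this suits finite-dimensional products, but in
  general not the time integral of a path.\<close>

lemma integral_process_law_cong:
  fixes X :: "real \<Rightarrow> 'w \<Rightarrow> 'e :: topological_space" and Y :: "real \<Rightarrow> 'v \<Rightarrow> 'e"
    and H :: "(real \<Rightarrow> 'e) \<Rightarrow> real"
  assumes "process_law I M X = process_law I N Y"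
    and X: "\<And>t. t \<in> I \<Longrightarrow> X t \<in> M \<rightarrow>\<^sub>M borel" and Y: "\<And>t. t \<in> I \<Longrightarrow> Y t \<in> N \<rightarrow>\<^sub>M borel"
    and [measurable]: "H \<in> borel_measurable (PiM I (\<lambda>_. borel))"
  shows "(\<integral>\<omega>. H (\<lambda>t\<in>I. X t \<omega>) \<partial>M) = (\<integral>\<omega>. H (\<lambda>t\<in>I. Y t \<omega>) \<partial>N)"
proof -
  have "(\<integral>\<omega>. H (\<lambda>t\<in>I. X t \<omega>) \<partial>M) = integral\<^sup>L (process_law I M X) H"
    unfolding process_law_def by (subst integral_distr) (auto intro!: measurable_restrict X)
  also have "\<dots> = integral\<^sup>L (process_law I N Y) H"
    by (simp only: assms)
  also have "\<dots> = (\<integral>\<omega>. H (\<lambda>t\<in>I. Y t \<omega>) \<partial>N)"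
    unfolding process_law_def by (subst integral_distr) (auto intro!: measurable_restrict Y)
  finally show ?thesis .
qed

section \<open>Time integrals of a measurable process\<close>

lemma time_integral_measurable:
  fixes f :: "real \<Rightarrow> 'w \<Rightarrow> real"
  assumes [measurable]: "(\<lambda>(s, \<omega>). f s \<omega>) \<in> borel_measurable (borel \<Otimes>\<^sub>M M)"
  shows "(\<lambda>\<omega>. LINT s:{0..t}|lborel. f s \<omega>) \<in> borel_measurable M"
  unfolding set_lebesgue_integral_def
  by measurable

lemma time_integrable:
  fixes f :: "real \<Rightarrow> real"
  assumes "f \<in> borel_measurable borel" "\<And>s. \<bar>f s\<bar> \<le> B"
  shows "set_integrable lborel {0..t} f"
  unfolding set_integrable_def
  by (rule integrableI_bounded_set_indicator[where B=B])
     (use assms in \<open>auto simp: emeasure_lborel_Icc_eq\<close>)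

lemma time_integral_bounds:
  fixes f :: "real \<Rightarrow> real"
  assumes [measurable]: "f \<in> borel_measurable borel" and f: "\<And>s. 0 \<le> f s" "\<And>s. f s \<le> B" and "0 \<le> t"
  shows "0 \<le> (LINT s:{0..t}|lborel. f s)" "(LINT s:{0..t}|lborel. f s) \<le> B * t"
proof -
  show "0 \<le> (LINT s:{0..t}|lborel. f s)"
    unfolding set_lebesgue_integral_def by (rule Bochner_Integration.integral_nonneg) (simp add: f)
  have "(LINT s:{0..t}|lborel. f s) \<le> (LINT s:{0..t}|lborel. B)"
    using f order_trans[OF f]
    by (intro set_integral_mono time_integrable[where B=B]) (auto simp: abs_of_nonneg)
  also have "\<dots> = B * t" using \<open>0 \<le> t\<close> by (simp add: set_lebesgue_integral_def mult.commute)
  finally show "(LINT s:{0..t}|lborel. f s) \<le> B * t" .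
qed

text \<open>Each application of Fubini trades one factor of the power for one more sampling time in
  the list \<open>ss\<close>, under an outer time integral. After \<open>n\<close> such steps only
  finite-dimensional expectations remain, and these agree by \<open>fdd\<close>. The list is
  arbitrary so that the induction on \<open>n\<close> can lengthen it.\<close>

lemma time_integral_moment_cong:
  fixes f :: "real \<Rightarrow> 'w \<Rightarrow> real" and g :: "real \<Rightarrow> 'v \<Rightarrow> real"
  assumes M: "prob_space M" and N: "prob_space N"
    and f: "(\<lambda>(s, \<omega>). f s \<omega>) \<in> borel_measurable (borel \<Otimes>\<^sub>M M)"
    and g: "(\<lambda>(s, \<omega>). g s \<omega>) \<in> borel_measurable (borel \<Otimes>\<^sub>M N)"
    and f_bd: "\<And>s \<omega>. 0 \<le> f s \<omega>" "\<And>s \<omega>. f s \<omega> \<le> B"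
    and g_bd: "\<And>s \<omega>. 0 \<le> g s \<omega>" "\<And>s \<omega>. g s \<omega> \<le> B"
    and fdd: "\<And>ss. (\<integral>\<omega>. (\<Prod>s\<leftarrow>ss. f s \<omega>) \<partial>M) = (\<integral>\<omega>. (\<Prod>s\<leftarrow>ss. g s \<omega>) \<partial>N)"
    and t: "0 \<le> t"
  shows "(\<integral>\<omega>. (LINT s:{0..t}|lborel. f s \<omega>) ^ n * (\<Prod>s\<leftarrow>ss. f s \<omega>) \<partial>M)
       = (\<integral>\<omega>. (LINT s:{0..t}|lborel. g s \<omega>) ^ n * (\<Prod>s\<leftarrow>ss. g s \<omega>) \<partial>N)"
proof -
  \<comment> \<open>Stated for an arbitrary probability space, so that the same identity serves both
    \<open>M\<close> with \<open>f\<close> and \<open>N\<close> with \<open>g\<close>.\<close>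
  have Fubini: "(\<integral>\<omega>. (LINT s:{0..t}|lborel. h s \<omega>) ^ Suc n * (\<Prod>s\<leftarrow>ss. h s \<omega>) \<partial>R)
      = (LINT s:{0..t}|lborel. (\<integral>\<omega>. (LINT s:{0..t}|lborel. h s \<omega>) ^ n * (\<Prod>s\<leftarrow>s # ss. h s \<omega>) \<partial>R))"
    if R: "prob_space R" and h [measurable]: "(\<lambda>(s, \<omega>). h s \<omega>) \<in> borel_measurable (borel \<Otimes>\<^sub>M R)"
      and h_bd: "\<And>s \<omega>. 0 \<le> h s \<omega>" "\<And>s \<omega>. h s \<omega> \<le> B"
    for R :: "'x measure" and h :: "real \<Rightarrow> 'x \<Rightarrow> real" and n ss
  proof -
    interpret R: prob_space R by fact
    interpret pair_sigma_finite lborel R ..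
    have [measurable]: "(\<lambda>\<omega>. h s \<omega>) \<in> borel_measurable R" for s
      using measurable_compose_Pair1[OF _ h, of s] by simp
    have hs: "(\<lambda>s. h s \<omega>) \<in> borel_measurable borel" if "\<omega> \<in> space R" for \<omega>
      using measurable_Pair1[OF h that] by simp
    define A where "A \<omega> = (LINT s:{0..t}|lborel. h s \<omega>)" for \<omega>
    define p where "p \<omega> = (\<Prod>s\<leftarrow>ss. h s \<omega>)" for \<omega>
    have A [measurable]: "A \<in> borel_measurable R"
      unfolding A_def by (rule time_integral_measurable[OF h])
    have p [measurable]: "p \<in> borel_measurable R"
      unfolding p_def by (induction ss) (auto intro!: borel_measurable_times)
    have A_bd: "0 \<le> A \<omega>" "A \<omega> \<le> B * t" if "\<omega> \<in> space R" for \<omega>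
      using time_integral_bounds[OF hs[OF that] h_bd t] by (auto simp: A_def)
    have B: "0 \<le> B" using order_trans[OF h_bd] .
    have p_bd: "0 \<le> p \<omega>" "p \<omega> \<le> B ^ length ss" for \<omega>
    proof -
      show "0 \<le> p \<omega>" unfolding p_def by (induction ss) (auto simp: h_bd)
      show "p \<omega> \<le> B ^ length ss" unfolding p_def
      proof (induction ss)
        case (Cons s ss)
        have "0 \<le> (\<Prod>s\<leftarrow>ss. h s \<omega>)" by (induction ss) (auto simp: h_bd)
        with Cons show ?case using h_bd B by (auto intro!: mult_mono)
      qed simp
    qed
    \<comment> \<open>The integrand is bounded and vanishes outside
      \<open>{0..t} \<times> space R\<close>, a set of finite product measure.\<close>
    have int: "integrable (lborel \<Otimes>\<^sub>M R) (\<lambda>(s, \<omega>). indicator {0..t} s * h s \<omega> * (A \<omega> ^ n * p \<omega>))"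
    proof (rule integrableI_bounded_set[where A="{0..t} \<times> space R" and B="B * ((B * t) ^ n * B ^ length ss)"])
      show "emeasure (lborel \<Otimes>\<^sub>M R) ({0..t} \<times> space R) < \<infinity>"
        by (subst R.emeasure_pair_measure_Times)
           (auto simp: R.emeasure_space_1 emeasure_lborel_Icc_eq)
      show "AE z in lborel \<Otimes>\<^sub>M R. z \<in> {0..t} \<times> space R \<longrightarrow>
          norm (case z of (s, \<omega>) \<Rightarrow> indicator {0..t} s * h s \<omega> * (A \<omega> ^ n * p \<omega>))
            \<le> B * ((B * t) ^ n * B ^ length ss)"
        using h_bd A_bd p_bd B t
        by (intro AE_I2) (auto simp: abs_mult intro!: mult_mono power_mono)
      show "AE z in lborel \<Otimes>\<^sub>M R. z \<notin> {0..t} \<times> space R \<longrightarrow>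
          (case z of (s, \<omega>) \<Rightarrow> indicator {0..t} s * h s \<omega> * (A \<omega> ^ n * p \<omega>)) = 0"
        by (intro AE_I2) (auto simp: space_pair_measure indicator_def)
    qed measurable
    \<comment> \<open>One factor \<open>A \<omega>\<close> is written out as a time integral, and
      the remaining factors do not depend on \<open>s\<close>. The rule used to pull them out
      requires no integrability, so the identity holds for every \<omega>.\<close>
    have A_eq: "A \<omega> ^ Suc n * p \<omega>
        = (\<integral>s. indicator {0..t} s * h s \<omega> * (A \<omega> ^ n * p \<omega>) \<partial>lborel)" for \<omega>
      unfolding integral_mult_left_zero by (simp add: A_def set_lebesgue_integral_def)
    have "(\<integral>\<omega>. A \<omega> ^ Suc n * p \<omega> \<partial>R)
        = (\<integral>\<omega>. (\<integral>s. indicator {0..t} s * h s \<omega> * (A \<omega> ^ n * p \<omega>) \<partial>lborel) \<partial>R)"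
      by (simp only: A_eq)
    also have "\<dots> = (\<integral>s. (\<integral>\<omega>. indicator {0..t} s * h s \<omega> * (A \<omega> ^ n * p \<omega>) \<partial>R) \<partial>lborel)"
      using Fubini_integral[OF int] by simp
    also have "\<dots> = (LINT s:{0..t}|lborel. (\<integral>\<omega>. A \<omega> ^ n * (h s \<omega> * p \<omega>) \<partial>R))"
      unfolding set_lebesgue_integral_def real_scaleR_def integral_mult_right_zero[symmetric]
      by (intro Bochner_Integration.integral_cong refl) (simp only: mult_ac)
    finally show ?thesis
      by (simp add: A_def p_def)
  qed
  show ?thesis
  proof (induction n arbitrary: ss)
    case 0
    show ?case by (simp add: fdd)
  next
    case (Suc n)
    show ?case
      unfolding Fubini[OF M f f_bd] Fubini[OF N g g_bd] Suc.IH ..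
  qed
qed

text \<open>The exponential series may be integrated term by term, its terms being dominated by
  \<open>B ^ n / fact n\<close>. Thus the Laplace transform of a bounded variable is determined by
  its moments.\<close>

lemma (in prob_space) expectation_exp_uminus_sums:
  fixes A :: "'a \<Rightarrow> real"
  assumes [measurable]: "A \<in> borel_measurable M"
    and bd: "\<And>\<omega>. \<omega> \<in> space M \<Longrightarrow> 0 \<le> A \<omega>" "\<And>\<omega>. \<omega> \<in> space M \<Longrightarrow> A \<omega> \<le> B"
  shows "(\<lambda>n. (- 1) ^ n / fact n * (\<integral>\<omega>. A \<omega> ^ n \<partial>M)) sums (\<integral>\<omega>. exp (- A \<omega>) \<partial>M)"
proof -
  obtain \<omega>0 where "\<omega>0 \<in> space M" using not_empty by blast
  then have B: "0 \<le> B" using bd[of \<omega>0] by auto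
  have sm: "summable (\<lambda>n. x ^ n / fact n)" for x :: real
    using summable_exp[of x] by (simp add: divide_inverse mult.commute)
  have bdn: "norm (((- A \<omega>) ^ n) / fact n) \<le> B ^ n / fact n" if "\<omega> \<in> space M" for \<omega> n
    using bd[OF that] by (auto simp: power_abs intro!: divide_right_mono power_mono)
  have int: "integrable M (\<lambda>\<omega>. ((- A \<omega>) ^ n) / fact n)" for n
    by (rule integrable_const_bound[where B="B ^ n / fact n"]) (use bdn in auto)
  have "(\<lambda>n. \<integral>\<omega>. ((- A \<omega>) ^ n) / fact n \<partial>M) sums (\<integral>\<omega>. (\<Sum>n. ((- A \<omega>) ^ n) / fact n) \<partial>M)"
  proof (rule sums_integral[OF int])
    show "AE \<omega> in M. summable (\<lambda>n. norm (((- A \<omega>) ^ n) / fact n))"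
    proof (rule AE_I2)
      fix \<omega> assume "\<omega> \<in> space M"
      then show "summable (\<lambda>n. norm (((- A \<omega>) ^ n) / fact n))"
        by (intro summable_comparison_test'[OF sm[of B], of 0]) (use bdn in simp)
    qed
    show "summable (\<lambda>n. \<integral>\<omega>. norm (((- A \<omega>) ^ n) / fact n) \<partial>M)"
    proof (rule summable_comparison_test'[OF sm[of B], of 0])
      fix n
      have "(\<integral>\<omega>. norm (((- A \<omega>) ^ n) / fact n) \<partial>M) \<le> (\<integral>\<omega>. B ^ n / fact n \<partial>M)"
        by (rule integral_mono) (use int[THEN integrable_norm] bdn in auto)
      then show "norm (\<integral>\<omega>. norm (((- A \<omega>) ^ n) / fact n) \<partial>M) \<le> B ^ n / fact n"
        by (simp add: prob_space)
    qed
  qed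
  moreover have "(\<integral>\<omega>. ((- A \<omega>) ^ n) / fact n \<partial>M) = (- 1) ^ n / fact n * (\<integral>\<omega>. A \<omega> ^ n \<partial>M)" for n
    by (simp add: power_minus[of "A _"])
  moreover have "(\<Sum>n. x ^ n / fact n) = exp x" for x :: real
    by (simp add: exp_def divide_inverse mult.commute)
  ultimately show ?thesis by simp
qed

lemma time_integral_exp_sums:
  fixes f :: "real \<Rightarrow> 'w \<Rightarrow> real"
  assumes M: "prob_space M"
    and f: "(\<lambda>(s, \<omega>). f s \<omega>) \<in> borel_measurable (borel \<Otimes>\<^sub>M M)"
    and bd: "\<And>s \<omega>. 0 \<le> f s \<omega>" "\<And>s \<omega>. f s \<omega> \<le> B"
    and t: "0 \<le> t"
  shows "(\<lambda>n. (- 1) ^ n / fact n * (\<integral>\<omega>. (LINT s:{0..t}|lborel. f s \<omega>) ^ n \<partial>M))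
    sums (\<integral>\<omega>. exp (- (LINT s:{0..t}|lborel. f s \<omega>)) \<partial>M)"
proof (rule prob_space.expectation_exp_uminus_sums[OF M time_integral_measurable[OF f]])
  fix \<omega> assume "\<omega> \<in> space M"
  then have "(\<lambda>s. f s \<omega>) \<in> borel_measurable borel"
    using measurable_Pair1[OF f] by simp
  note time_integral_bounds[OF this bd t]
  then show "0 \<le> (LINT s:{0..t}|lborel. f s \<omega>)" "(LINT s:{0..t}|lborel. f s \<omega>) \<le> B * t" .
qed

text \<open>The moments agree, by the previous moment identity with the empty list, so both
  expectations are sums of the same series.\<close>

lemma time_integral_exp_cong:
  fixes f :: "real \<Rightarrow> 'w \<Rightarrow> real" and g :: "real \<Rightarrow> 'v \<Rightarrow> real"
  assumes M: "prob_space M" and N: "prob_space N"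
    and f: "(\<lambda>(s, \<omega>). f s \<omega>) \<in> borel_measurable (borel \<Otimes>\<^sub>M M)"
    and g: "(\<lambda>(s, \<omega>). g s \<omega>) \<in> borel_measurable (borel \<Otimes>\<^sub>M N)"
    and f_bd: "\<And>s \<omega>. 0 \<le> f s \<omega>" "\<And>s \<omega>. f s \<omega> \<le> B"
    and g_bd: "\<And>s \<omega>. 0 \<le> g s \<omega>" "\<And>s \<omega>. g s \<omega> \<le> B"
    and fdd: "\<And>ss. (\<integral>\<omega>. (\<Prod>s\<leftarrow>ss. f s \<omega>) \<partial>M) = (\<integral>\<omega>. (\<Prod>s\<leftarrow>ss. g s \<omega>) \<partial>N)"
    and t: "0 \<le> t"
  shows "(\<integral>\<omega>. exp (- (LINT s:{0..t}|lborel. f s \<omega>)) \<partial>M)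
       = (\<integral>\<omega>. exp (- (LINT s:{0..t}|lborel. g s \<omega>)) \<partial>N)"
proof -
  have "(\<integral>\<omega>. (LINT s:{0..t}|lborel. f s \<omega>) ^ n \<partial>M)
      = (\<integral>\<omega>. (LINT s:{0..t}|lborel. g s \<omega>) ^ n \<partial>N)" for n
    using time_integral_moment_cong[OF M N f g f_bd g_bd fdd t, of n "[]"] by simp
  with time_integral_exp_sums[OF M f f_bd t] time_integral_exp_sums[OF N g g_bd t]
  show ?thesis by (simp only: sums_unique2)
qed

text \<open>The exceptional null set in \<open>diff\<close> depends on \<open>s\<close>, and there
  are uncountably many times. Joint measurability lets Fubini exchange the two almost-everywhere
  quantifiers: for almost every \<omega> the bound holds at Lebesgue-almost every \<open>s\<close>,
  which suffices for integration.\<close>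

lemma time_integral_diff_le_AE:
  fixes f g :: "real \<Rightarrow> 'w \<Rightarrow> real"
  assumes M: "prob_space M"
    and f [measurable]: "(\<lambda>(s, \<omega>). f s \<omega>) \<in> borel_measurable (borel \<Otimes>\<^sub>M M)"
    and g [measurable]: "(\<lambda>(s, \<omega>). g s \<omega>) \<in> borel_measurable (borel \<Otimes>\<^sub>M M)"
    and bd: "\<And>s \<omega>. \<bar>f s \<omega>\<bar> \<le> B" "\<And>s \<omega>. \<bar>g s \<omega>\<bar> \<le> B"
    and \<phi> [measurable]: "\<phi> \<in> borel_measurable borel" and int_\<phi>: "set_integrable lborel {0..t} \<phi>"
    and diff: "\<And>s. 0 \<le> s \<Longrightarrow> AE \<omega> in M. \<bar>f s \<omega> - g s \<omega>\<bar> \<le> \<phi> s"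
  shows "AE \<omega> in M. \<bar>(LINT s:{0..t}|lborel. f s \<omega>) - (LINT s:{0..t}|lborel. g s \<omega>)\<bar>
    \<le> (LINT s:{0..t}|lborel. \<phi> s)"
proof -
  interpret prob_space M by fact
  interpret pair_sigma_finite lborel M ..
  have "AE s in lborel. AE \<omega> in M. s \<in> {0..t} \<longrightarrow> \<bar>f s \<omega> - g s \<omega>\<bar> \<le> \<phi> s"
    by (rule AE_I2) (use diff in auto)
  then have "AE \<omega> in M. AE s in lborel. s \<in> {0..t} \<longrightarrow> \<bar>f s \<omega> - g s \<omega>\<bar> \<le> \<phi> s"
    by (rule AE_commute[THEN iffD1, rotated]) measurable
  then show ?thesis
  proof (rule AE_mp, intro AE_I2 impI)
    fix \<omega> assume \<omega>: "\<omega> \<in> space M"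
      and ae: "AE s in lborel. s \<in> {0..t} \<longrightarrow> \<bar>f s \<omega> - g s \<omega>\<bar> \<le> \<phi> s"
    have int: "set_integrable lborel {0..t} (\<lambda>s. f s \<omega>)" "set_integrable lborel {0..t} (\<lambda>s. g s \<omega>)"
      by (rule time_integrable[where B=B]; use measurable_Pair1[OF f \<omega>] measurable_Pair1[OF g \<omega>] bd in simp)+
    note diff_int = set_integral_diff[OF int]
    have "\<bar>(LINT s:{0..t}|lborel. f s \<omega>) - (LINT s:{0..t}|lborel. g s \<omega>)\<bar>
        \<le> (LINT s:{0..t}|lborel. \<bar>f s \<omega> - g s \<omega>\<bar>)"
      using set_integral_norm_bound[OF diff_int(1)] by (simp add: diff_int(2))
    also have "\<dots> \<le> (LINT s:{0..t}|lborel. \<phi> s)"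
      using ae by (intro set_integral_mono_AE set_integrable_abs diff_int(1) int_\<phi>) auto
    finally show "\<bar>(LINT s:{0..t}|lborel. f s \<omega>) - (LINT s:{0..t}|lborel. g s \<omega>)\<bar>
        \<le> (LINT s:{0..t}|lborel. \<phi> s)" .
  qed
qed

lemma time_integral_exp_decay_le:
  fixes \<gamma> c t :: real
  assumes "0 < \<gamma>" "0 \<le> c" "0 \<le> t"
  shows "(LINT s:{0..t}|lborel. c * exp (- \<gamma> * s)) \<le> c / \<gamma>"
proof -
  have "(LINT s:{0..t}|lborel. c * exp (- \<gamma> * s))
      = - c / \<gamma> * exp (- \<gamma> * t) - (- c / \<gamma> * exp (- \<gamma> * 0))"
    unfolding set_lebesgue_integral_def
    by (rule integral_FTC_atLeastAtMost[OF \<open>0 \<le> t\<close>])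
       (use assms in \<open>auto intro!: derivative_eq_intros continuous_intros
          simp flip: has_real_derivative_iff_has_vector_derivative\<close>)
  also have "\<dots> \<le> c / \<gamma>"
    using assms by simp
  finally show ?thesis .
qed

section \<open>The penalization exponent\<close>

text \<open>Minus the logarithm of \<open>penal\<close>. It turns the product of discrete time into
  a sum, so that both time sets lead to additive functionals to be compared.\<close>

definition penal_exponent :: "real set \<Rightarrow> ('e \<Rightarrow> real) \<Rightarrow> (real \<Rightarrow> 'w \<Rightarrow> 'e) \<Rightarrow> real \<Rightarrow> 'w \<Rightarrow> real"
  where
  "penal_exponent I \<rho> X t \<omega> =
     (if I = {0..} then LINT s:{0..t}|lborel. \<rho> (X s \<omega>)
      else (\<Sum>k<nat \<lfloor>t\<rfloor>. \<rho> (X (real k) \<omega>)))"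

lemma penal_eq_exp: "penal I \<rho> X t \<omega> = exp (- penal_exponent I \<rho> X t \<omega>)"
  by (simp add: penal_def penal_exponent_def exp_sum flip: sum_negf)

lemma penal_exponent_nonneg:
  assumes "\<And>x. 0 \<le> \<rho> x"
  shows "0 \<le> penal_exponent I \<rho> X t \<omega>"
  unfolding penal_exponent_def set_lebesgue_integral_def
  by (auto intro!: sum_nonneg Bochner_Integration.integral_nonneg simp: assms)

text \<open>Freezing the path at negative times makes the measurable process total, so that
  integrals over \<open>{0..t}\<close> can be computed on \<open>lborel\<close> itself.\<close>

lemma penal_well_defined_frozen:
  assumes "penal_well_defined {0..} \<rho> M X"
  shows "(\<lambda>(s, \<omega>). \<rho> (X (max 0 s) \<omega>)) \<in> borel_measurable (borel \<Otimes>\<^sub>M M)"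
proof -
  have "(\<lambda>z. (max 0 (fst z), snd z)) \<in> borel \<Otimes>\<^sub>M M \<rightarrow>\<^sub>M restrict_space borel {0::real..} \<Otimes>\<^sub>M M"
    by (intro measurable_Pair measurable_restrict_space2) auto
  from measurable_compose[OF this, of "\<lambda>(s, \<omega>). \<rho> (X s \<omega>)" borel] assms show ?thesis
    by (simp add: penal_well_defined_def case_prod_unfold)
qed

lemma penal_exponent_frozen:
  "penal_exponent {0..} \<rho> X t \<omega> = (LINT s:{0..t}|lborel. \<rho> (X (max 0 s) \<omega>))"
  unfolding penal_exponent_def
  by (auto intro!: set_lebesgue_integral_cong simp: max_def)

text \<open>The definitions branch on \<open>I = {0..}\<close>, so this is what selects the discrete
  branch. The point 1/2 separates the two sets.\<close>

lemma Nats_neq_atLeast_0: "(\<nat> :: real set) \<noteq> {0..}"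
proof
  assume "(\<nat> :: real set) = {0..}"
  moreover have "(1 / 2 :: real) \<in> {0..}" by simp
  ultimately have "(1 / 2 :: real) \<in> \<nat>" by (simp only:)
  then obtain n where "(1 / 2 :: real) = real n" by (auto simp: Nats_def)
  then have "real 1 = real (2 * n)" by simp
  then have "1 = 2 * n" by (subst (asm) of_nat_eq_iff)
  then show False by presburger
qed

lemma penal_exponent_measurable:
  assumes time: "I = {0..} \<or> I = \<nat>"
    and X: "\<And>t. t \<in> I \<Longrightarrow> X t \<in> M \<rightarrow>\<^sub>M borel" and [measurable]: "\<rho> \<in> borel_measurable borel"
    and wd: "penal_well_defined I \<rho> M X"
  shows "penal_exponent I \<rho> X t \<in> borel_measurable M"
  using time
proof
  assume I: "I = {0..}"
  show ?thesis
    unfolding I penal_exponent_frozen[abs_def]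
    by (rule time_integral_measurable[OF penal_well_defined_frozen]) (use wd I in simp)
next
  assume I: "I = \<nat>"
  have [measurable]: "X (real k) \<in> M \<rightarrow>\<^sub>M borel" for k
    by (rule X) (simp add: I)
  show ?thesis
    unfolding I penal_exponent_def[abs_def] using Nats_neq_atLeast_0 by simp
qed

text \<open>Identifies the normalization under \<open>P x\<close> with an expectation on the
  coupling space. In discrete time the penalization depends on finitely many coordinates; in
  continuous time the passage goes through the moments of the exponent.\<close>

lemma integral_penal_law_cong:
  fixes X :: "real \<Rightarrow> 'w \<Rightarrow> 'e :: topological_space" and Y :: "real \<Rightarrow> 'v \<Rightarrow> 'e"
  assumes time: "I = {0..} \<or> I = \<nat>" and t: "t \<in> I"
    and M: "prob_space M" and N: "prob_space N"
    and X: "\<And>t. t \<in> I \<Longrightarrow> X t \<in> M \<rightarrow>\<^sub>M borel" and Y: "\<And>t. t \<in> I \<Longrightarrow> Y t \<in> N \<rightarrow>\<^sub>M borel"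
    and law: "process_law I M X = process_law I N Y"
    and wdX: "penal_well_defined I \<rho> M X" and wdY: "penal_well_defined I \<rho> N Y"
    and \<rho> [measurable]: "\<rho> \<in> borel_measurable borel"
    and bd: "\<And>x. 0 \<le> \<rho> x" "\<And>x. \<rho> x \<le> B"
  shows "(\<integral>\<omega>. penal I \<rho> X t \<omega> \<partial>M) = (\<integral>\<omega>. penal I \<rho> Y t \<omega> \<partial>N)"
  using time
proof
  assume I: "I = {0..}"
  have fdd: "(\<integral>\<omega>. (\<Prod>s\<leftarrow>ss. \<rho> (X (max 0 s) \<omega>)) \<partial>M) = (\<integral>\<omega>. (\<Prod>s\<leftarrow>ss. \<rho> (Y (max 0 s) \<omega>)) \<partial>N)"
    for ss
  proof -
    have comp: "(\<lambda>x. \<rho> (x (max 0 s))) \<in> borel_measurable (PiM I (\<lambda>_. borel))" for s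
      by (rule measurable_compose[OF measurable_component_singleton[of _ I "\<lambda>_. borel"] \<rho>]) (simp add: I)
    have "(\<lambda>x. \<Prod>s\<leftarrow>ss. \<rho> (x (max 0 s))) \<in> borel_measurable (PiM I (\<lambda>_. borel))"
      by (induction ss) (auto intro!: borel_measurable_times comp)
    from integral_process_law_cong[OF law X Y this] show ?thesis
      by (simp add: I)
  qed
  show ?thesis
    unfolding penal_eq_exp I penal_exponent_frozen
    by (rule time_integral_exp_cong[where f="\<lambda>s \<omega>. \<rho> (X (max 0 s) \<omega>)"
          and g="\<lambda>s \<omega>. \<rho> (Y (max 0 s) \<omega>)", OF M N _ _ bd bd fdd])
       (use t wdX wdY in \<open>simp_all add: I penal_well_defined_frozen\<close>)
next
  assume I: "I = \<nat>"
  have comp: "(\<lambda>x. \<rho> (x (real k))) \<in> borel_measurable (PiM I (\<lambda>_. borel))" for k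
    by (rule measurable_compose[OF measurable_component_singleton[of _ I "\<lambda>_. borel"] \<rho>]) (simp add: I)
  have "(\<lambda>x. \<Prod>k<nat \<lfloor>t\<rfloor>. exp (- \<rho> (x (real k)))) \<in> borel_measurable (PiM I (\<lambda>_. borel))"
    using comp by measurable
  from integral_process_law_cong[OF law X Y this] show ?thesis
    using Nats_neq_atLeast_0 by (simp add: I penal_def)
qed

text \<open>The Lipschitz bound and the contraction make the running cost differ by at most
  \<open>l * c * exp (- \<gamma> * s)\<close> at time \<open>s\<close>. The total mass of this bound
  is a full integral or a full geometric series, hence an estimate uniform in
  \<open>t\<close>.\<close>

lemma penal_exponent_diff_le_AE:
  fixes X Y :: "real \<Rightarrow> 'w \<Rightarrow> 'e :: metric_space"
  assumes time: "I = {0..} \<or> I = \<nat>" and t: "t \<in> I" and M: "prob_space M"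
    and wdX: "penal_well_defined I \<rho> M X" and wdY: "penal_well_defined I \<rho> M Y"
    and bd: "\<And>x. 0 \<le> \<rho> x" "\<And>x. \<rho> x \<le> B"
    and lip: "\<And>x y. \<bar>\<rho> x - \<rho> y\<bar> \<le> l * dist x y" and l: "0 \<le> l"
    and c: "0 \<le> c" and \<gamma>: "0 < \<gamma>"
    and contr: "\<And>t. t \<in> I \<Longrightarrow> AE \<omega> in M. dist (X t \<omega>) (Y t \<omega>) \<le> c * exp (- \<gamma> * t)"
  shows "AE \<omega> in M. \<bar>penal_exponent I \<rho> X t \<omega> - penal_exponent I \<rho> Y t \<omega>\<bar>
    \<le> l * c / (if I = {0..} then \<gamma> else 1 - exp (- \<gamma>))"
proof -
  have diff: "AE \<omega> in M. \<bar>\<rho> (X s \<omega>) - \<rho> (Y s \<omega>)\<bar> \<le> l * c * exp (- \<gamma> * s)" if "s \<in> I" for s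
    using contr[OF that]
  proof eventually_elim
    case (elim \<omega>)
    from mult_left_mono[OF elim l] lip[of "X s \<omega>" "Y s \<omega>"] show ?case
      by (simp add: mult.assoc)
  qed
  from time show ?thesis
  proof
    assume I: "I = {0..}"
    have abs_bd: "\<bar>\<rho> x\<bar> \<le> B" for x
      using bd[of x] by simp
    have "AE \<omega> in M. \<bar>penal_exponent I \<rho> X t \<omega> - penal_exponent I \<rho> Y t \<omega>\<bar>
        \<le> (LINT s:{0..t}|lborel. l * c * exp (- \<gamma> * s))"
      unfolding I penal_exponent_frozen
    proof (rule time_integral_diff_le_AE[OF M _ _ abs_bd abs_bd])
      show "set_integrable lborel {0..t} (\<lambda>s. l * c * exp (- \<gamma> * s))"
        by (intro borel_integrable_atLeastAtMost' continuous_intros)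
      show "(\<lambda>(s, \<omega>). \<rho> (X (max 0 s) \<omega>)) \<in> borel_measurable (borel \<Otimes>\<^sub>M M)"
        "(\<lambda>(s, \<omega>). \<rho> (Y (max 0 s) \<omega>)) \<in> borel_measurable (borel \<Otimes>\<^sub>M M)"
        using wdX wdY by (simp_all add: I penal_well_defined_frozen)
    qed (use diff in \<open>simp_all add: I max_absorb2\<close>)
    moreover have "(LINT s:{0..t}|lborel. l * c * exp (- \<gamma> * s)) \<le> l * c / \<gamma>"
      using t l c by (intro time_integral_exp_decay_le \<gamma>) (auto simp: I)
    ultimately show ?thesis
      by (auto simp: I)
  next
    assume I: "I = \<nat>"
    \<comment> \<open>In discrete time the exceptional sets are countably many, so one null set
      serves all times.\<close>
    have "AE \<omega> in M. \<forall>k. \<bar>\<rho> (X (real k) \<omega>) - \<rho> (Y (real k) \<omega>)\<bar> \<le> l * c * exp (- \<gamma>) ^ k"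
      unfolding AE_all_countable
      using diff[of "real _"] by (auto simp: I mult.commute[of \<gamma>] simp flip: exp_of_nat_mult)
    then have "AE \<omega> in M. \<bar>penal_exponent I \<rho> X t \<omega> - penal_exponent I \<rho> Y t \<omega>\<bar>
        \<le> l * c / (1 - exp (- \<gamma>))"
    proof eventually_elim
      case (elim \<omega>)
      have "\<bar>penal_exponent I \<rho> X t \<omega> - penal_exponent I \<rho> Y t \<omega>\<bar>
          \<le> (\<Sum>k<nat \<lfloor>t\<rfloor>. \<bar>\<rho> (X (real k) \<omega>) - \<rho> (Y (real k) \<omega>)\<bar>)"
        using Nats_neq_atLeast_0 by (simp add: penal_exponent_def I flip: sum_subtractf)
      also have "\<dots> \<le> (\<Sum>k<nat \<lfloor>t\<rfloor>. l * c * exp (- \<gamma>) ^ k)"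
        using elim by (intro sum_mono) auto
      also have "\<dots> = l * c * (\<Sum>k<nat \<lfloor>t\<rfloor>. exp (- \<gamma>) ^ k)"
        by (simp add: sum_distrib_left)
      also have "\<dots> \<le> l * c * (\<Sum>k. exp (- \<gamma>) ^ k)"
        using l c \<gamma> by (intro mult_left_mono sum_le_suminf summable_geometric) auto
      also have "\<dots> = l * c / (1 - exp (- \<gamma>))"
        using \<gamma> by (subst suminf_geometric) auto
      finally show ?case .
    qed
    then show ?thesis
      using Nats_neq_atLeast_0 by (simp add: I)
  qed
qed

section \<open>Constants and assembly of the three bounds\<close>

text \<open>In continuous time the two sides are equal. In discrete time \<open>const_B\<close>
  carries the additional factor \<open>exp (osc \<rho>)\<close>, which is at least 1, in both places
  where \<kappa> occurs.\<close>

lemma const_B_ge: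
  fixes I :: "real set" and \<rho> :: "'e :: metric_space \<Rightarrow> real"
  assumes "0 \<le> lip_norm \<rho>" "0 \<le> osc \<rho>" "0 < C\<^sub>0" "0 < \<gamma>" "0 \<le> dbar"
  defines "\<kappa> \<equiv> lip_norm \<rho> * C\<^sub>0 / (if I = {0..} then \<gamma> else 1 - exp (- \<gamma>))"
  shows "\<kappa> * exp (\<kappa> * dbar) \<le> const_B I \<rho> C\<^sub>0 \<gamma> dbar"
proof (cases "I = {0..}")
  case False
  have \<kappa>: "\<kappa> = lip_norm \<rho> * C\<^sub>0 / (1 - exp (- \<gamma>))" "0 \<le> \<kappa>"
    using False assms(1-5) by (auto simp: \<kappa>_def)
  then have le: "\<kappa> \<le> \<kappa> * exp (osc \<rho>)"
    using assms(2) mult_left_mono[of 1 "exp (osc \<rho>)" \<kappa>] by simp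
  then have "\<kappa> * exp (\<kappa> * dbar) \<le> \<kappa> * exp (osc \<rho>) * exp (\<kappa> * exp (osc \<rho>) * dbar)"
    using \<kappa>(2) assms(5) by (intro mult_mono) (auto intro!: mult_right_mono)
  also have "\<dots> = const_B I \<rho> C\<^sub>0 \<gamma> dbar"
    using False by (simp add: const_B_def \<kappa>(1) mult_ac)
  finally show ?thesis .
qed (simp add: const_B_def \<kappa>_def)

theorem proposition3p2:
  fixes I :: "real set"
    and F :: "real \<Rightarrow> 'w measure"
    and P :: "'e :: polish_space \<Rightarrow> 'w measure"
    and X :: "real \<Rightarrow> 'w \<Rightarrow> 'e"
    and \<rho> :: "'e \<Rightarrow> real"
    and Q :: "'e \<Rightarrow> 'e \<Rightarrow> 'v measure"
    and X' Y' :: "'e \<Rightarrow> 'e \<Rightarrow> real \<Rightarrow> 'v \<Rightarrow> 'e"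
    and dbar C\<^sub>0 \<gamma> :: real
  assumes time: "I = {0..} \<or> I = \<nat>"
    and dist_bounded: "\<And>x y :: 'e. dist x y \<le> dbar"
    and markov: "homogeneous_markov_process I F P X"
    and rho_nonneg: "\<And>x. 0 \<le> \<rho> x"
    and rho_lipschitz: "\<exists>L. L-lipschitz_on UNIV \<rho>"
    and penal_X: "\<And>x. penal_well_defined I \<rho> (P x) X"
    and C0_pos: "0 < C\<^sub>0"
    and gamma_pos: "0 < \<gamma>"
    and coupling: "\<And>x y. markovian_coupling I P X x y (Q x y) (X' x y) (Y' x y)"
    and penal_X': "\<And>x y. penal_well_defined I \<rho> (Q x y) (X' x y)"
    and penal_Y': "\<And>x y. penal_well_defined I \<rho> (Q x y) (Y' x y)"
    and contraction: "\<And>x y t. t \<in> I \<Longrightarrow>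
      AE \<omega> in Q x y. dist (X' x y t \<omega>) (Y' x y t \<omega>) \<le> C\<^sub>0 * exp (- \<gamma> * t) * dist x y"
  shows "\<forall>x y. \<forall>t\<in>I.
    (let EZ = (\<lambda>z. \<integral>\<omega>. penal I \<rho> X t \<omega> \<partial>P z);
         ZX = penal I \<rho> (X' x y) t;
         ZY = penal I \<rho> (Y' x y) t;
         GX = (\<lambda>\<omega>. ZX \<omega> / EZ x);
         GY = (\<lambda>\<omega>. ZY \<omega> / EZ y);
         CB = const_B I \<rho> C\<^sub>0 \<gamma> dbar;
         CC = (1 + CB * dbar)\<^sup>2
     in (\<integral>\<omega>. GX \<omega> * dist (X' x y t \<omega>) (Y' x y t \<omega>) \<partial>Q x y) \<le> C\<^sub>0 * exp (- \<gamma> * t) * dist x y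
      \<and> (\<integral>\<omega>. \<bar>ZX \<omega> - ZY \<omega>\<bar> \<partial>Q x y) \<le> CB * dist x y * EZ x
      \<and> (\<integral>\<omega>. min (GX \<omega>) (GY \<omega>) \<partial>Q x y) \<ge> 1 / CC)"
proof -
  obtain L where L: "L-lipschitz_on UNIV \<rho>"
    using rho_lipschitz by blast
  have \<rho>_meas: "\<rho> \<in> borel_measurable borel"
    using L by (intro borel_measurable_continuous_onI lipschitz_on_continuous_on)
  note lip = lip_norm_bound[OF rho_lipschitz]
  have dbar: "0 \<le> dbar"
    using dist_bounded[of undefined undefined] by simp
  \<comment> \<open>A Lipschitz function on a space of diameter at most \<open>dbar\<close> is
    bounded; \<open>undefined\<close> serves as an arbitrary base point.\<close>
  define B where "B = \<rho> undefined + lip_norm \<rho> * dbar"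
  have \<rho>_le: "\<rho> x \<le> B" for x
  proof -
    have "\<bar>\<rho> x - \<rho> undefined\<bar> \<le> lip_norm \<rho> * dbar"
      using lip(2)[of x undefined] mult_left_mono[OF dist_bounded lip(1)] by (rule order_trans)
    then show ?thesis by (simp add: B_def)
  qed
  have osc: "0 \<le> osc \<rho>"
    by (intro osc_nonneg bdd_aboveI2[OF \<rho>_le] bdd_belowI2[OF rho_nonneg])
  have P: "prob_space (P x)" for x
    using markov by (simp add: homogeneous_markov_process_def)
  have X: "X t \<in> P x \<rightarrow>\<^sub>M borel" if "t \<in> I" for x t
    using markov that
    by (intro measurable_from_subalg[of "P x" "F t"]) (simp_all add: homogeneous_markov_process_def)
  define CB where "CB = const_B I \<rho> C\<^sub>0 \<gamma> dbar"
  define \<kappa> where "\<kappa> = lip_norm \<rho> * C\<^sub>0 / (if I = {0..} then \<gamma> else 1 - exp (- \<gamma>))"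
  have \<kappa>: "0 \<le> \<kappa>"
    using lip(1) C0_pos gamma_pos by (simp add: \<kappa>_def)
  have CB: "\<kappa> * exp (\<kappa> * dbar) \<le> CB"
    unfolding CB_def \<kappa>_def by (intro const_B_ge lip(1) osc C0_pos gamma_pos dbar)
  then have CB0: "0 \<le> CB"
    using \<kappa> by (meson exp_ge_zero mult_nonneg_nonneg order_trans)
  {
    fix x y t assume t: "t \<in> I"
    have Q: "prob_space (Q x y)"
      and X': "\<And>t. t \<in> I \<Longrightarrow> X' x y t \<in> Q x y \<rightarrow>\<^sub>M borel"
      and Y': "\<And>t. t \<in> I \<Longrightarrow> Y' x y t \<in> Q x y \<rightarrow>\<^sub>M borel"
      and lawX: "process_law I (Q x y) (X' x y) = process_law I (P x) X"
      and lawY: "process_law I (Q x y) (Y' x y) = process_law I (P y) X"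
      using coupling[of x y] by (auto simp: markovian_coupling_def coupling_def)
    define a where "a = penal_exponent I \<rho> (X' x y) t"
    define b where "b = penal_exponent I \<rho> (Y' x y) t"
    \<comment> \<open>The normalizations become integrals over the coupling space, where both
      weights live and can be compared pathwise.\<close>
    have EX: "(\<integral>\<omega>. exp (- a \<omega>) \<partial>Q x y) = (\<integral>\<omega>. penal I \<rho> X t \<omega> \<partial>P x)"
      unfolding a_def penal_eq_exp[symmetric]
      by (intro integral_penal_law_cong[OF time t Q P _ _ lawX, where B=B] X' X penal_X penal_X'
          \<rho>_meas rho_nonneg \<rho>_le)
    have EY: "(\<integral>\<omega>. exp (- b \<omega>) \<partial>Q x y) = (\<integral>\<omega>. penal I \<rho> X t \<omega> \<partial>P y)"
      unfolding b_def penal_eq_exp[symmetric]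
      by (intro integral_penal_law_cong[OF time t Q P _ _ lawY, where B=B] Y' X penal_X penal_Y'
          \<rho>_meas rho_nonneg \<rho>_le)
    define K where "K = \<kappa> * dist x y"
    have diff: "AE \<omega> in Q x y. \<bar>a \<omega> - b \<omega>\<bar> \<le> K"
    proof -
      \<comment> \<open>For fixed \<open>x\<close> and \<open>y\<close> the product
        \<open>C\<^sub>0 * dist x y\<close> plays the part of the constant \<open>c\<close> in the
        exponent estimate.\<close>
      have "AE \<omega> in Q x y. dist (X' x y s \<omega>) (Y' x y s \<omega>) \<le> C\<^sub>0 * dist x y * exp (- \<gamma> * s)"
        if "s \<in> I" for s
        using contraction[OF that, of x y] by (simp add: mult_ac)
      then have "AE \<omega> in Q x y. \<bar>a \<omega> - b \<omega>\<bar>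
          \<le> lip_norm \<rho> * (C\<^sub>0 * dist x y) / (if I = {0..} then \<gamma> else 1 - exp (- \<gamma>))"
        unfolding a_def b_def using C0_pos
        by (intro penal_exponent_diff_le_AE[OF time t Q penal_X' penal_Y' rho_nonneg \<rho>_le
              lip(2) lip(1) _ gamma_pos]) auto
      then show ?thesis by (simp add: K_def \<kappa>_def mult_ac)
    qed
    \<comment> \<open>The distance is replaced by \<open>dbar\<close> inside the exponential only;
      the factor in front keeps \<open>dist x y\<close>, as (B) requires.\<close>
    have K: "K * exp K \<le> CB * dist x y"
    proof -
      have "K * exp K \<le> K * exp (\<kappa> * dbar)"
        using \<kappa> dist_bounded by (auto simp: K_def intro!: mult_left_mono)
      also have "\<dots> = \<kappa> * exp (\<kappa> * dbar) * dist x y"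
        by (simp add: K_def)
      also have "\<dots> \<le> CB * dist x y"
        using CB by (intro mult_right_mono) auto
      finally show ?thesis .
    qed
    \<comment> \<open>Squared, this turns the constant \<open>(exp K)\<^sup>2\<close> of the
      abstract third bound into the constant of (C).\<close>
    have "exp K \<le> 1 + CB * dbar"
    proof -
      have "exp K \<le> 1 + K * exp K"
        by (rule exp_le_one_plus_mult_exp)
      also have "\<dots> \<le> 1 + CB * dbar"
        using K mult_left_mono[OF dist_bounded CB0, of x y] by linarith
      finally show ?thesis .
    qed
    then have CC: "1 / (1 + CB * dbar)\<^sup>2 \<le> 1 / (exp K)\<^sup>2"
      by (intro divide_left_mono power_mono) (auto intro!: mult_pos_pos add_pos_nonneg mult_nonneg_nonneg CB0 dbar)
    have L0: "0 \<le> C\<^sub>0 * exp (- \<gamma> * t) * dist x y"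
      using C0_pos by simp
    have am: "a \<in> borel_measurable (Q x y)"
      unfolding a_def by (intro penal_exponent_measurable time X' \<rho>_meas penal_X')
    have bm: "b \<in> borel_measurable (Q x y)"
      unfolding b_def by (intro penal_exponent_measurable time Y' \<rho>_meas penal_Y')
    have a0: "0 \<le> a \<omega>" "0 \<le> b \<omega>" for \<omega>
      unfolding a_def b_def by (intro penal_exponent_nonneg rho_nonneg)+
    note bounds = prob_space.penalized_coupling_bounds[OF Q am bm a0 diff contraction[OF t] L0,
        unfolded EX EY]
    have "0 \<le> (\<integral>\<omega>. penal I \<rho> X t \<omega> \<partial>P x)"
      unfolding EX[symmetric] by simp
    note mult_right_mono[OF K this]
    note bounds(1) order_trans[OF bounds(2) this] order_trans[OF CC bounds(3)]
  }
  then show ?thesis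
    unfolding Let_def penal_eq_exp CB_def by simp
qed

end
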